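(* Let $I\in\mathbb{H}$ be a unit imaginary quaternion and let $\Lambda=(\lambda_1,\ldots,\lambda_n)$ be a configuration in $\mathbb{H}^m$ all of whose coefficients lie in the complex slice $\mathbb{C}_I$, i.e. $\lambda_\alpha\in\mathbb{C}_I^m$ for every $\alpha$. Let $$\widetilde\Lambda=(\lambda_1,\lambda_1,\ldots,\lambda_n,\lambda_n)$$ be the duplicated configuration. Then $$Z_{\mathbb H}(\Lambda)\cong Z_{\mathbb C}(\widetilde\Lambda),$$ under the identification $\mathbb{H}^n\cong\mathbb{C}_I^{2n}$ given by writing $q_\alpha=z_\alpha+Jw_\alpha$ with $z_\alpha,w_\alpha\in\mathbb{C}_I$, where $J$ is a unit imaginary quaternion orthogonal to $I$.
   Context: $\mathbb{H}$ denotes the quaternions and $\mathbb{C}_I=\{a+bI:a,b\in\mathbb{R}\}\subset\mathbb{H}$. Define $$Z_{\mathbb H}(\Lambda)=\Big\{q\in\mathbb{H}^n:\ \sum_{\alpha=1}^n\lambda_\alpha|q_\alpha|^2=0,\ \sum_{\alpha=1}^n|q_\alpha|^2=1\Big\},$$ and, for a configuration $M=(\mu_1,\ldots,\mu_N)$ in $\mathbb{C}_I^m$, $$Z_{\mathbb C}(M)=\Big\{z\in\mathbb{C}_I^N:\ \sum_{k=1}^N\mu_k|z_k|^2=0,\ \sum_{k=1}^N|z_k|^2=1\Big\}.$$ The coordinates of $\mathbb{C}_I^{2n}$ are ordered as $(z_1,w_1,\ldots,z_n,w_n)$. *)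

theory Defs
  imports "HOL-Analysis.Analysis"
begin

section \<open>The real normed division algebra of quaternions\<close>

datatype quat = Quat (qRe: real) (qIm1: real) (qIm2: real) (qIm3: real)

lemma quat_eq_iff:
  "x = y \<longleftrightarrow> qRe x = qRe y \<and> qIm1 x = qIm1 y \<and> qIm2 x = qIm2 y \<and> qIm3 x = qIm3 y"
  by (cases x; cases y) auto

instantiation quat :: ring_1
begin

definition "0 = Quat 0 0 0 0"
definition "1 = Quat 1 0 0 0"
definition "x + y = Quat (qRe x + qRe y) (qIm1 x + qIm1 y) (qIm2 x + qIm2 y) (qIm3 x + qIm3 y)"
definition "- x = Quat (- qRe x) (- qIm1 x) (- qIm2 x) (- qIm3 x)"
definition "x - y = Quat (qRe x - qRe y) (qIm1 x - qIm1 y) (qIm2 x - qIm2 y) (qIm3 x - qIm3 y)"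
definition "x * y = Quat
  (qRe x * qRe y - qIm1 x * qIm1 y - qIm2 x * qIm2 y - qIm3 x * qIm3 y)
  (qRe x * qIm1 y + qIm1 x * qRe y + qIm2 x * qIm3 y - qIm3 x * qIm2 y)
  (qRe x * qIm2 y - qIm1 x * qIm3 y + qIm2 x * qRe y + qIm3 x * qIm1 y)
  (qRe x * qIm3 y + qIm1 x * qIm2 y - qIm2 x * qIm1 y + qIm3 x * qRe y)"

instance
  by standard
    (auto simp: quat_eq_iff zero_quat_def one_quat_def plus_quat_def uminus_quat_def
      minus_quat_def times_quat_def algebra_simps)

end

instantiation quat :: real_algebra_1
begin

definition "r *\<^sub>R x = Quat (r * qRe x) (r * qIm1 x) (r * qIm2 x) (r * qIm3 x)"

instance
  by standard
    (auto simp: quat_eq_iff plus_quat_def times_quat_def scaleR_quat_def algebra_simps)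

end

lemma quat_sel_simps [simp]:
  "qRe 0 = 0" "qIm1 0 = 0" "qIm2 0 = 0" "qIm3 0 = 0"
  "qRe 1 = 1" "qIm1 1 = 0" "qIm2 1 = 0" "qIm3 1 = 0"
  "qRe (x + y) = qRe x + qRe y" "qIm1 (x + y) = qIm1 x + qIm1 y"
  "qIm2 (x + y) = qIm2 x + qIm2 y" "qIm3 (x + y) = qIm3 x + qIm3 y"
  "qRe (- x) = - qRe x" "qIm1 (- x) = - qIm1 x"
  "qIm2 (- x) = - qIm2 x" "qIm3 (- x) = - qIm3 x"
  "qRe (x - y) = qRe x - qRe y" "qIm1 (x - y) = qIm1 x - qIm1 y"
  "qIm2 (x - y) = qIm2 x - qIm2 y" "qIm3 (x - y) = qIm3 x - qIm3 y"
  "qRe (r *\<^sub>R x) = r * qRe x" "qIm1 (r *\<^sub>R x) = r * qIm1 x"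
  "qIm2 (r *\<^sub>R x) = r * qIm2 x" "qIm3 (r *\<^sub>R x) = r * qIm3 x"
  by (auto simp: zero_quat_def one_quat_def plus_quat_def uminus_quat_def
      minus_quat_def scaleR_quat_def)

lemma quat_times_sel:
  "qRe (x * y) = qRe x * qRe y - qIm1 x * qIm1 y - qIm2 x * qIm2 y - qIm3 x * qIm3 y"
  "qIm1 (x * y) = qRe x * qIm1 y + qIm1 x * qRe y + qIm2 x * qIm3 y - qIm3 x * qIm2 y"
  "qIm2 (x * y) = qRe x * qIm2 y - qIm1 x * qIm3 y + qIm2 x * qRe y + qIm3 x * qIm1 y"
  "qIm3 (x * y) = qRe x * qIm3 y + qIm1 x * qIm2 y - qIm2 x * qIm1 y + qIm3 x * qRe y"
  by (auto simp: times_quat_def)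

instantiation quat :: real_inner
begin

definition "inner x y =
  qRe x * qRe y + qIm1 x * qIm1 y + qIm2 x * qIm2 y + qIm3 x * qIm3 (y::quat)"
definition "norm (x::quat) = sqrt (inner x x)"
definition "sgn (x::quat) = x /\<^sub>R norm x"
definition "dist (x::quat) y = norm (x - y)"
definition [code del]:
  "(uniformity :: (quat \<times> quat) filter) = (INF e\<in>{0<..}. principal {(x, y). dist x y < e})"
definition [code del]:
  "open (U :: quat set) \<longleftrightarrow> (\<forall>x\<in>U. eventually (\<lambda>(x', y). x' = x \<longrightarrow> y \<in> U) uniformity)"

instance
proof
  fix x y z :: quat and r :: real
  show "dist x y = norm (x - y)" by (rule dist_quat_def)
  show "sgn x = x /\<^sub>R norm x" by (rule sgn_quat_def)
  show "uniformity = (INF e\<in>{0<..}. principal {(x::quat, y). dist x y < e})"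
    by (rule uniformity_quat_def)
  show "open U \<longleftrightarrow> (\<forall>x\<in>U. \<forall>\<^sub>F (x', y) in uniformity. x' = x \<longrightarrow> y \<in> U)" for U :: "quat set"
    by (rule open_quat_def)
  show "norm x = sqrt (inner x x)" by (rule norm_quat_def)
  show "inner x y = inner y x" by (simp add: inner_quat_def mult.commute)
  show "inner (x + y) z = inner x z + inner y z" by (simp add: inner_quat_def algebra_simps)
  show "inner (r *\<^sub>R x) y = r * inner x y" by (simp add: inner_quat_def algebra_simps)
  show "0 \<le> inner x x" by (simp add: inner_quat_def)
  show "inner x x = 0 \<longleftrightarrow> x = 0"
    by (auto simp: inner_quat_def quat_eq_iff add_nonneg_eq_0_iff)
qed

end

lemma inner_mult_quat: "inner (x * y) (x * y) = inner x x * inner y (y::quat)"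
  by (simp add: inner_quat_def quat_times_sel algebra_simps)

instantiation quat :: real_normed_div_algebra
begin

definition "inverse x = Quat (qRe x) (- qIm1 x) (- qIm2 x) (- qIm3 x) /\<^sub>R inner x x"
definition "x div y = x * inverse (y::quat)"

instance
proof
  fix x y :: quat
  show "x div y = x * inverse y" by (rule divide_quat_def)
  show "inverse (0::quat) = 0" by (simp add: inverse_quat_def)
  show "norm (x * y) = norm x * norm y"
    by (simp add: norm_quat_def inner_mult_quat real_sqrt_mult)
  assume "x \<noteq> 0"
  then have n: "inner x x \<noteq> 0" by simp
  let ?c = "Quat (qRe x) (- qIm1 x) (- qIm2 x) (- qIm3 x)"
  have c: "?c * x = inner x x *\<^sub>R 1" "x * ?c = inner x x *\<^sub>R 1"
    by (simp_all add: quat_eq_iff quat_times_sel inner_quat_def)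
  show "inverse x * x = 1" "x * inverse x = 1"
    unfolding inverse_quat_def mult_scaleR_left mult_scaleR_right c scaleR_scaleR left_inverse[OF n]
    by (rule scaleR_one)+
qed

end

instantiation quat :: euclidean_space
begin

definition "Basis = {Quat 1 0 0 0, Quat 0 1 0 0, Quat 0 0 1 0, Quat 0 0 0 1}"

instance
proof
  fix u v x :: quat
  show "(Basis :: quat set) \<noteq> {}" "finite (Basis :: quat set)"
    by (simp_all add: Basis_quat_def)
  show "inner u v = (if u = v then 1 else 0)" if "u \<in> Basis" "v \<in> Basis"
    using that unfolding Basis_quat_def by (elim insertE emptyE) (simp_all add: inner_quat_def)
  show "(\<forall>u\<in>Basis. inner x u = 0) \<longleftrightarrow> x = 0"
    unfolding Basis_quat_def quat_eq_iff[of x 0] by (simp add: inner_quat_def)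
qed

end


section \<open>Slices and intersections of quadrics\<close>

definition unit_imaginary :: "quat \<Rightarrow> bool" where
  "unit_imaginary I \<longleftrightarrow> qRe I = 0 \<and> norm I = 1"

definition slice :: "quat \<Rightarrow> quat set" where
  "slice I = {of_real a + of_real b * I |a b. True}"

definition slice_vec :: "quat \<Rightarrow> (quat ^ 'n) set" where
  "slice_vec I = {z. \<forall>k. z $ k \<in> slice I}"

text \<open>A configuration of \<open>n\<close> vectors in \<open>\<bbbH>\<close>-space of dimension \<open>m\<close> has type \<open>quat ^ 'm ^ 'n\<close>;
  its \<open>\<alpha>\<close>-th vector is \<open>\<Lambda> $ \<alpha>\<close>.\<close>

definition Z_H :: "quat ^ 'm ^ 'n \<Rightarrow> (quat ^ 'n) set" where
  "Z_H \<Lambda> = {q. (\<Sum>\<alpha>\<in>UNIV. (norm (q $ \<alpha>))\<^sup>2 *\<^sub>R \<Lambda> $ \<alpha>) = 0 \<and> (\<Sum>\<alpha>\<in>UNIV. (norm (q $ \<alpha>))\<^sup>2) = 1}"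

definition Z_C :: "quat \<Rightarrow> quat ^ 'm ^ 'k \<Rightarrow> (quat ^ 'k) set" where
  "Z_C I M = {z \<in> slice_vec I.
     (\<Sum>k\<in>UNIV. (norm (z $ k))\<^sup>2 *\<^sub>R M $ k) = 0 \<and> (\<Sum>k\<in>UNIV. (norm (z $ k))\<^sup>2) = 1}"

text \<open>The \<open>2n\<close> coordinates \<open>(z\<^sub>1, w\<^sub>1, \<dots>, z\<^sub>n, w\<^sub>n)\<close> are indexed by \<open>'n \<times> bool\<close> in lexicographic
  order: \<open>(\<alpha>, False)\<close> is the position of \<open>z\<^sub>\<alpha>\<close> and \<open>(\<alpha>, True)\<close> that of \<open>w\<^sub>\<alpha>\<close>.\<close>

definition duplicate :: "'a ^ 'n \<Rightarrow> 'a ^ ('n \<times> bool)" where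
  "duplicate \<Lambda> = (\<chi> k. \<Lambda> $ fst k)"

definition identification :: "quat \<Rightarrow> quat ^ ('n \<times> bool) \<Rightarrow> quat ^ 'n" where
  "identification J u = (\<chi> \<alpha>. u $ (\<alpha>, False) + J * u $ (\<alpha>, True))"

end

theory Submission
  imports Defs
begin

text \<open>For orthogonal unit imaginaries \<open>I\<close>, \<open>J\<close> the family \<open>1, I, J, J I\<close> is orthonormal and spans the
  quaternions: an element orthogonal to all four anticommutes with \<open>I\<close>, \<open>J\<close> and \<open>J I\<close>, which forces
  it to vanish. So every \<open>q\<close> is uniquely \<open>z + J w\<close> with \<open>z = P q\<close> and \<open>w = P (- J q)\<close>, where \<open>P\<close> is
  the orthogonal projection onto the slice, and \<open>|q|\<^sup>2 = |z|\<^sup>2 + |w|\<^sup>2\<close> matches the defining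
  equations on both sides.\<close>

lemma inner_quat_one: "inner x (1::quat) = qRe x" "inner (1::quat) x = qRe x"
  by (simp_all add: inner_quat_def)

text \<open>Polarised form of the multiplicativity of the norm: multiplication by a unit
  \<open>a\<close> is an isometry, so a common factor cancels inside an inner product.\<close>

lemma inner_mult_quat_left: "inner (a * x) (a * y) = inner a a * inner x (y::quat)"
  by (simp add: inner_quat_def quat_times_sel algebra_simps)

lemma inner_mult_quat_right: "inner (x * a) (y * a) = inner a a * inner x (y::quat)"
  by (simp add: inner_quat_def quat_times_sel algebra_simps)

text \<open>For imaginary quaternions, \<open>x * y + y * x\<close> is the real number
  \<open>-2 * inner x y\<close>.\<close>

lemma imaginary_anticommute:
  assumes "qRe x = 0" "qRe y = 0" "inner x y = 0"
  shows "x * y = - (y * x)"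
  using assms by (simp add: quat_eq_iff quat_times_sel inner_quat_def)

lemma unit_imaginary_inner_self: "unit_imaginary I \<Longrightarrow> inner I I = 1"
  by (simp add: unit_imaginary_def norm_eq_1)

lemma unit_imaginary_square:
  assumes "unit_imaginary I"
  shows "I * I = -1"
  using assms unit_imaginary_inner_self[OF assms]
  by (simp add: unit_imaginary_def quat_eq_iff quat_times_sel inner_quat_def)

definition slice_proj :: "quat \<Rightarrow> quat \<Rightarrow> quat" where
  "slice_proj I x = inner x 1 *\<^sub>R 1 + inner x I *\<^sub>R I"

lemma linear_slice_proj: "linear (slice_proj I)"
  by (rule linearI) (simp_all add: slice_proj_def inner_add_left algebra_simps)

lemma slice_proj_in_slice: "slice_proj I x \<in> slice I"
  unfolding slice_proj_def slice_def of_real_def by fastforce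

lemma slice_cases:
  assumes "z \<in> slice I"
  obtains a b where "z = a *\<^sub>R 1 + b *\<^sub>R I"
  using assms by (auto simp: slice_def of_real_def)

context
  fixes I J :: quat
  assumes I: "unit_imaginary I" and J: "unit_imaginary J" and IJ: "orthogonal I J"
begin

lemma slice_basis_inner:
  "inner (1::quat) 1 = 1" "inner I I = 1" "inner J J = 1" "inner (J * I) (J * I) = 1"
  "inner 1 I = 0" "inner I 1 = 0" "inner 1 J = 0" "inner J 1 = 0" "inner I J = 0" "inner J I = 0"
  "inner (J * I) 1 = 0" "inner 1 (J * I) = 0" "inner (J * I) I = 0" "inner I (J * I) = 0"
  "inner (J * I) J = 0" "inner J (J * I) = 0"
proof -
  show *: "inner (1::quat) 1 = 1" "inner I I = 1" "inner J J = 1"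
    "inner 1 I = 0" "inner I 1 = 0" "inner 1 J = 0" "inner J 1 = 0" "inner I J = 0" "inner J I = 0"
    using I J IJ unit_imaginary_inner_self
    by (auto simp: unit_imaginary_def orthogonal_def inner_quat_one inner_commute)
  show "inner (J * I) (J * I) = 1"
    by (simp add: inner_mult_quat *)
  \<comment> \<open>Cancel the right factor \<open>I\<close> from \<open>J * I\<close> and
    \<open>1 * I\<close>; the next case cancels the left factor \<open>J\<close> from
    \<open>J * I\<close> and \<open>J * 1\<close>.\<close>
  show "inner (J * I) I = 0" "inner I (J * I) = 0"
    using inner_mult_quat_right[of J I 1] by (simp_all add: * inner_commute)
  show "inner (J * I) J = 0" "inner J (J * I) = 0"
    using inner_mult_quat_left[of J I 1] by (simp_all add: * inner_commute)
  show "inner (J * I) 1 = 0" "inner 1 (J * I) = 0"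
    using \<open>inner J I = 0\<close> I J
    by (simp_all add: inner_quat_one quat_times_sel inner_quat_def unit_imaginary_def)
qed

lemma orthogonal_to_slice_basis:
  assumes "inner d 1 = 0" "inner d I = 0" "inner d J = 0" "inner d (J * I) = 0"
  shows "d = 0"
proof -
  have re: "qRe d = 0" "qRe I = 0" "qRe J = 0" "qRe (J * I) = 0"
    using assms slice_basis_inner by (simp_all add: inner_quat_one(1)[symmetric])
  have dI: "d * I = - (I * d)" and dJ: "d * J = - (J * d)" and dJI: "d * (J * I) = - ((J * I) * d)"
    using assms re by (blast intro: imaginary_anticommute)+
  \<comment> \<open>Moving \<open>d\<close> past \<open>J\<close> and then past \<open>I\<close>
    changes the sign twice, so \<open>d\<close> commutes with \<open>J * I\<close> as well as
    anticommuting with it.\<close>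
  have "d * (J * I) = - (J * (d * I))"
    using dJ by (simp flip: mult.assoc)
  also have "\<dots> = (J * I) * d"
    by (simp add: dI mult.assoc)
  finally have "(J * I) * d = - ((J * I) * d)"
    using dJI by simp
  then have "(J * I) * d = 0"
    by (simp add: quat_eq_iff)
  moreover have "J * I \<noteq> 0"
    using slice_basis_inner(4) by auto
  ultimately show ?thesis by simp
qed

lemma J_mult_J: "J * (J * x) = - x"
  using unit_imaginary_square[OF J] by (simp flip: mult.assoc)

lemma slice_decomposition: "slice_proj I q + J * slice_proj I (- (J * q)) = q"
proof -
  \<comment> \<open>The adjoint of left multiplication by \<open>- J\<close> is left multiplication
    by \<open>J\<close>; hence the second summand carries the coefficients of \<open>q\<close> along
    \<open>J\<close> and \<open>J * I\<close>.\<close>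
  have inn: "inner (- (J * q)) x = inner q (J * x)" for x
    using inner_mult_quat_left[of J q "J * x"] by (simp add: slice_basis_inner J_mult_J)
  \<comment> \<open>This is \<open>q\<close> minus its orthonormal expansion. Deleting
    \<open>inner_minus_left\<close> keeps the left side of \<open>inn\<close> intact for
    rewriting.\<close>
  have "q - (slice_proj I q + J * slice_proj I (- (J * q))) = 0"
    by (rule orthogonal_to_slice_basis)
      (simp_all add: slice_proj_def inn inner_diff_left inner_add_left distrib_left slice_basis_inner
        del: inner_minus_left)
  then show ?thesis by simp
qed

lemma slice_proj_components:
  assumes "z \<in> slice I" "w \<in> slice I"
  shows "slice_proj I (z + J * w) = z" "slice_proj I (- (J * (z + J * w))) = w"
proof -
  obtain a b where z: "z = a *\<^sub>R 1 + b *\<^sub>R I" using assms slice_cases by blast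
  obtain c d where w: "w = c *\<^sub>R 1 + d *\<^sub>R I" using assms slice_cases by blast
  show "slice_proj I (z + J * w) = z"
    by (simp add: z w slice_proj_def inner_add_left distrib_left slice_basis_inner)
  \<comment> \<open>Multiplying by \<open>- J\<close> exchanges the two roles: now \<open>w\<close>
    is the slice part and \<open>J * z\<close> is orthogonal to the slice.\<close>
  have "- (J * (z + J * w)) = w - J * z"
    by (simp add: distrib_left J_mult_J)
  then show "slice_proj I (- (J * (z + J * w))) = w"
    by (simp add: z w slice_proj_def inner_add_left inner_diff_left distrib_left slice_basis_inner)
qed

text \<open>Pythagoras: \<open>J\<close> carries the slice isometrically into its orthogonal
  complement.\<close>

lemma norm_slice_sum:
  assumes "z \<in> slice I" "w \<in> slice I"
  shows "(norm (z + J * w))\<^sup>2 = (norm z)\<^sup>2 + (norm w)\<^sup>2"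
proof -
  obtain a b where z: "z = a *\<^sub>R 1 + b *\<^sub>R I" using assms slice_cases by blast
  obtain c d where w: "w = c *\<^sub>R 1 + d *\<^sub>R I" using assms slice_cases by blast
  have "inner z (J * w) = 0"
    by (simp add: z w inner_add_left inner_add_right distrib_left slice_basis_inner)
  then have "(norm (z + J * w))\<^sup>2 = (norm z)\<^sup>2 + (norm (J * w))\<^sup>2"
    by (simp add: power2_norm_eq_inner inner_add_left inner_add_right inner_commute)
  then show ?thesis
    using J by (simp add: norm_mult unit_imaginary_def)
qed

end

text \<open>Intended inverse of \<open>identification J\<close> restricted to
  \<open>slice_vec I\<close>; a true second index selects the coordinate \<open>w\<close>.\<close>

definition slice_coords :: "quat \<Rightarrow> quat \<Rightarrow> quat ^ 'n \<Rightarrow> quat ^ ('n \<times> bool)" where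
  "slice_coords I J q =
    (\<chi> k. slice_proj I (if snd k then - (J * q $ fst k) else q $ fst k))"

lemma linear_identification: "linear (identification J)"
  by (rule linearI) (simp_all add: identification_def vec_eq_iff algebra_simps)

lemma linear_slice_coords: "linear (slice_coords I J)"
  by (rule linearI)
    (simp_all add: slice_coords_def vec_eq_iff distrib_left
      linear_add[OF linear_slice_proj] linear_diff[OF linear_slice_proj] linear_neg[OF linear_slice_proj]
      linear_scale[OF linear_slice_proj])

lemma slice_coords_in_slice_vec: "slice_coords I J q \<in> slice_vec I"
  by (simp add: slice_vec_def slice_coords_def slice_proj_in_slice)

lemma sum_prod_bool:
  fixes f :: "'n::finite \<times> bool \<Rightarrow> 'a::comm_monoid_add"
  shows "(\<Sum>k\<in>UNIV. f k) = (\<Sum>\<alpha>\<in>UNIV. f (\<alpha>, False) + f (\<alpha>, True))"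
proof -
  have "(\<Sum>k\<in>UNIV. f k) = (\<Sum>\<alpha>\<in>UNIV. \<Sum>b\<in>UNIV. f (\<alpha>, b))"
    by (simp add: sum.cartesian_product)
  then show ?thesis by (simp add: UNIV_bool)
qed

text \<open>The weight of each vector of \<Lambda> splits into the weights of its two copies in
  \<open>duplicate \<Lambda>\<close>.\<close>

lemma identification_in_Z_H_iff:
  assumes "unit_imaginary I" "unit_imaginary J" "orthogonal I J" "u \<in> slice_vec I"
  shows "identification J u \<in> Z_H \<Lambda> \<longleftrightarrow> u \<in> Z_C I (duplicate \<Lambda>)"
proof -
  have "(norm (identification J u $ \<alpha>))\<^sup>2 = (norm (u $ (\<alpha>, False)))\<^sup>2 + (norm (u $ (\<alpha>, True)))\<^sup>2" for \<alpha>
    using assms by (simp add: identification_def slice_vec_def norm_slice_sum)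
  then show ?thesis
    using assms(4) by (simp add: Z_H_def Z_C_def duplicate_def sum_prod_bool scaleR_add_left)
qed

theorem proposition12p2:
  fixes I J :: quat and \<Lambda> :: "quat ^ 'm ^ 'n"
  assumes "unit_imaginary I"
    and "unit_imaginary J"
    and "orthogonal I J"
    and "\<forall>\<alpha>. \<Lambda> $ \<alpha> \<in> slice_vec I"
  shows "\<exists>\<psi> :: quat ^ 'n \<Rightarrow> quat ^ ('n \<times> bool).
    linear (identification J :: quat ^ ('n \<times> bool) \<Rightarrow> quat ^ 'n) \<and> linear \<psi> \<and>
    homeomorphism (slice_vec I) UNIV (identification J) \<psi> \<and>
    homeomorphism (Z_C I (duplicate \<Lambda>)) (Z_H \<Lambda>) (identification J) \<psi>"
proof (intro exI conjI)
  let ?\<phi> = "identification J :: quat ^ ('n \<times> bool) \<Rightarrow> quat ^ 'n"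
  let ?\<psi> = "slice_coords I J :: quat ^ 'n \<Rightarrow> quat ^ ('n \<times> bool)"
  show "linear ?\<phi>" "linear ?\<psi>"
    by (fact linear_identification linear_slice_coords)+
  have left: "?\<psi> (?\<phi> u) = u" if "u \<in> slice_vec I" for u
    using that slice_proj_components[OF assms(1-3)]
    by (auto simp: slice_coords_def identification_def slice_vec_def vec_eq_iff)
  have right: "?\<phi> (?\<psi> q) = q" for q
    by (simp add: slice_coords_def identification_def vec_eq_iff slice_decomposition[OF assms(1-3)])
  \<comment> \<open>Continuity is automatic for linear maps between finite-dimensional
    spaces.\<close>
  show hom: "homeomorphism (slice_vec I) UNIV ?\<phi> ?\<psi>"
    by (rule homeomorphismI)
      (use left right slice_coords_in_slice_vec[of I J] in
        \<open>auto intro!: linear_continuous_on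
          simp: linear_conv_bounded_linear[symmetric] linear_identification linear_slice_coords\<close>)
  have "?\<phi> ` Z_C I (duplicate \<Lambda>) = Z_H \<Lambda>"
  proof (intro equalityI subsetI)
    fix q assume "q \<in> Z_H \<Lambda>"
    \<comment> \<open>Apply the equivalence to \<open>?\<psi> q\<close>, whose image under
      \<open>?\<phi>\<close> is \<open>q\<close>.\<close>
    then have "?\<psi> q \<in> Z_C I (duplicate \<Lambda>)"
      using identification_in_Z_H_iff[OF assms(1-3) slice_coords_in_slice_vec] right by metis
    then show "q \<in> ?\<phi> ` Z_C I (duplicate \<Lambda>)"
      using right by (metis image_eqI)
  qed (use identification_in_Z_H_iff[OF assms(1-3)] in \<open>auto simp: Z_C_def\<close>)
  then show "homeomorphism (Z_C I (duplicate \<Lambda>)) (Z_H \<Lambda>) ?\<phi> ?\<psi>"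
    by (intro homeomorphism_of_subsets[OF hom]) (auto simp: Z_C_def)
qed

end
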